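(* Let $R>0$. The area of the region inside a circle of radius $R$ in the Euclidean plane is $\pi R^{2}$.
   Context: Area is the usual area of a region in the Euclidean plane. The number $\pi$ is the ratio of the circumference of a circle to its diameter, so that a full turn measures $2\pi$ radians, where the radian measure of a central angle of a circle of radius $1$ is the length of the arc it subtends. *)

theory Defs
  imports "HOL-Analysis.Analysis"
begin

text \<open>
  The library introduces \<^const>\<open>pi\<close> through the first positive zero of the cosine. The lemmas
  below identify it with the geometric number: the circumference of every circle is
  \<^const>\<open>pi\<close> times its diameter, and radian measure is arc length on the unit circle.
  Length is the supremum of the lengths of inscribed polygons.
\<close>

definition curve_length :: "(real \<Rightarrow> 'a::metric_space) \<Rightarrow> real \<Rightarrow> real \<Rightarrow> ereal" where
  "curve_length g a b =
     Sup {ereal (\<Sum>i<n. dist (g (p i)) (g (p (Suc i)))) |(n::nat) p.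
            p 0 = a \<and> p n = b \<and> (\<forall>i<n. p i \<le> p (Suc i))}"

definition circle_point :: "real^2 \<Rightarrow> real \<Rightarrow> real \<Rightarrow> real^2" where
  "circle_point c R t = c + R *\<^sub>R vector [cos t, sin t]"

lemma norm_real2: "norm (x::real^2) = sqrt ((x $ 1)\<^sup>2 + (x $ 2)\<^sup>2)"
  by (simp add: norm_vec_def L2_set_def sum_2)

text \<open>The parametrisation runs through the circle exactly once on \<open>[0, 2 pi)\<close>.\<close>

lemma circle_point_bij:
  assumes "R > 0"
  shows "bij_betw (circle_point c R) {0..<2 * pi} (sphere c R)"
  unfolding bij_betw_def
proof (intro conjI)
  show "inj_on (circle_point c R) {0..<2 * pi}"
  proof (rule inj_onI)
    fix s t assume st: "s \<in> {0..<2 * pi}" "t \<in> {0..<2 * pi}"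
      and eq: "circle_point c R s = circle_point c R t"
    from eq assms have "vector [cos s, sin s] = (vector [cos t, sin t] :: real^2)"
      by (simp add: circle_point_def)
    then have "cos s = cos t" "sin s = sin t"
      by (metis vector_2)+
    then have "sin s = sin t \<and> cos s = cos t" by simp
    then obtain n where n: "s = t + 2 * pi * of_int n"
      using sin_cos_eq_iff by blast
    have "2 * pi * \<bar>of_int n\<bar> < 2 * pi * 1"
    proof -
      have "\<bar>s - t\<bar> < 2 * pi" using st by auto
      moreover have "\<bar>s - t\<bar> = 2 * pi * \<bar>of_int n\<bar>" by (simp add: n abs_mult)
      ultimately show ?thesis by simp
    qed
    then have "\<bar>of_int n :: real\<bar> < 1"
      by (subst (asm) mult_less_cancel_left_pos) auto
    then have "n = 0" by linarith
    then show "s = t" using n by simp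
  qed
  show "circle_point c R ` {0..<2 * pi} = sphere c R"
  proof
    show "circle_point c R ` {0..<2 * pi} \<subseteq> sphere c R"
      using assms
      by (auto simp: circle_point_def dist_norm norm_real2 power_mult_distrib
          distrib_left [symmetric])
    show "sphere c R \<subseteq> circle_point c R ` {0..<2 * pi}"
    proof
      fix x assume "x \<in> sphere c R"
      then have "norm (x - c) = R" by (simp add: dist_norm norm_minus_commute)
      then have sq: "((x - c) $ 1)\<^sup>2 + ((x - c) $ 2)\<^sup>2 = R\<^sup>2"
        by (metis norm_real2 norm_ge_zero real_sqrt_ge_0_iff real_sqrt_pow2)
      then have "((x - c) $ 1 / R)\<^sup>2 + ((x - c) $ 2 / R)\<^sup>2 = 1"
        using assms by (simp add: power_divide add_divide_distrib [symmetric])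
      then obtain t where t: "0 \<le> t" "t < 2 * pi"
        "(x - c) $ 1 / R = cos t" "(x - c) $ 2 / R = sin t"
        using sincos_total_2pi by metis
      then have "x = circle_point c R t"
        using assms by (simp add: circle_point_def vec_eq_iff forall_2 field_simps)
      then show "x \<in> circle_point c R ` {0..<2 * pi}" using t by auto
    qed
  qed
qed

lemma dist_circle_point:
  assumes "R \<ge> 0"
  shows "dist (circle_point c R s) (circle_point c R t) = 2 * R * \<bar>sin ((t - s) / 2)\<bar>"
proof -
  have "(cos s - cos t)\<^sup>2 + (sin s - sin t)\<^sup>2 = 2 - 2 * cos (t - s)"
    using sin_cos_squared_add3 [of s] sin_cos_squared_add3 [of t]
    by (simp add: cos_diff power2_eq_square algebra_simps)
  also have "\<dots> = 4 * (sin ((t - s) / 2))\<^sup>2"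
  proof -
    define h where "h = (t - s) / 2"
    have "t - s = 2 * h" by (simp add: h_def)
    then show ?thesis by (simp add: h_def [symmetric] cos_double_sin)
  qed
  finally have *: "(cos s - cos t)\<^sup>2 + (sin s - sin t)\<^sup>2 = (2 * sin ((t - s) / 2))\<^sup>2"
    by (simp add: power_mult_distrib)
  have "dist (circle_point c R s) (circle_point c R t)
      = norm (R *\<^sub>R (vector [cos s, sin s] - vector [cos t, sin t] :: real^2))"
    by (simp add: circle_point_def dist_norm scaleR_diff_right)
  also have "\<dots> = R * sqrt ((cos s - cos t)\<^sup>2 + (sin s - sin t)\<^sup>2)"
    unfolding norm_scaleR using assms by (simp add: norm_real2)
  also have "\<dots> = 2 * R * \<bar>sin ((t - s) / 2)\<bar>"
    unfolding * real_sqrt_abs by (simp add: abs_mult)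
  finally show ?thesis .
qed

lemma curve_length_circle_arc:
  assumes "R > 0" "\<theta> \<ge> 0"
  shows "curve_length (circle_point c R) 0 \<theta> = ereal (R * \<theta>)"
  unfolding curve_length_def
proof (rule antisym)
  show "Sup {ereal (\<Sum>i<n. dist (circle_point c R (p i)) (circle_point c R (p (Suc i)))) |(n::nat) p.
            p 0 = 0 \<and> p n = \<theta> \<and> (\<forall>i<n. p i \<le> p (Suc i))} \<le> ereal (R * \<theta>)"
  proof (rule Sup_least, clarify)
    fix n :: nat and p :: "nat \<Rightarrow> real"
    assume p: "p 0 = 0" "\<theta> = p n" "\<forall>i<n. p i \<le> p (Suc i)"
    have "(\<Sum>i<n. dist (circle_point c R (p i)) (circle_point c R (p (Suc i))))
        \<le> (\<Sum>i<n. R * (p (Suc i) - p i))"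
    proof (rule sum_mono)
      fix i assume "i \<in> {..<n}"
      then have "p i \<le> p (Suc i)" using p by auto
      then have "\<bar>sin ((p (Suc i) - p i) / 2)\<bar> \<le> (p (Suc i) - p i) / 2"
        using abs_sin_x_le_abs_x [of "(p (Suc i) - p i) / 2"] by simp
      then have "2 * R * \<bar>sin ((p (Suc i) - p i) / 2)\<bar> \<le> 2 * R * ((p (Suc i) - p i) / 2)"
        using assms by (intro mult_left_mono) auto
      then show "dist (circle_point c R (p i)) (circle_point c R (p (Suc i))) \<le> R * (p (Suc i) - p i)"
        using assms by (simp add: dist_circle_point)
    qed
    also have "\<dots> = R * (p n - p 0)"
      by (simp add: sum_distrib_left [symmetric] sum_lessThan_telescope)
    finally show "ereal (\<Sum>i<n. dist (circle_point c R (p i)) (circle_point c R (p (Suc i))))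
        \<le> ereal (R * p n)"
      using p by simp
  qed
next
  let ?S = "{ereal (\<Sum>i<n. dist (circle_point c R (p i)) (circle_point c R (p (Suc i)))) |(n::nat) p.
            p 0 = 0 \<and> p n = \<theta> \<and> (\<forall>i<n. p i \<le> p (Suc i))}"
  define f where "f = (\<lambda>n. R * (2 * real (Suc n) * \<bar>sin (\<theta> / (2 * real (Suc n)))\<bar>))"
  have le: "ereal (f n) \<le> Sup ?S" for n
  proof (rule Sup_upper, rule CollectI, intro exI conjI)
    let ?p = "\<lambda>i. \<theta> * real i / real (Suc n)"
    show "?p 0 = 0" "?p (Suc n) = \<theta>" by (auto simp: field_simps)
    show "\<forall>i<Suc n. ?p i \<le> ?p (Suc i)"
      using assms by (auto intro!: divide_right_mono mult_left_mono)
    have d: "?p (Suc i) - ?p i = \<theta> / real (Suc n)" for i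
      by (simp add: diff_divide_distrib [symmetric] algebra_simps)
    show "ereal (f n) = ereal (\<Sum>i<Suc n. dist (circle_point c R (?p i)) (circle_point c R (?p (Suc i))))"
      unfolding dist_circle_point [OF less_imp_le [OF assms(1)]] d
      by (simp add: f_def algebra_simps)
  qed
  have "f \<longlonglongrightarrow> R * \<theta>"
  proof (cases "\<theta> = 0")
    case True
    then show ?thesis by (simp add: f_def)
  next
    case False
    define x where "x = (\<lambda>n. \<theta> / (2 * real (Suc n)))"
    have "(\<lambda>n. (\<theta> / 2) * inverse (real (Suc n))) \<longlonglongrightarrow> (\<theta> / 2) * 0"
      by (intro tendsto_mult tendsto_const LIMSEQ_inverse_real_of_nat)
    then have "x \<longlonglongrightarrow> 0" by (simp add: x_def field_simps)
    moreover have "x n \<noteq> 0" for n using False by (simp add: x_def)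
    ultimately have "filterlim x (at 0) sequentially"
      by (simp add: filterlim_at)
    moreover have "((\<lambda>y::real. sin y / y) \<longlongrightarrow> 1) (at 0)"
      using DERIV_sin [of 0] by (simp add: has_field_derivative_iff)
    ultimately have "(\<lambda>n. sin (x n) / x n) \<longlonglongrightarrow> 1"
      by (rule filterlim_compose [rotated])
    then have "(\<lambda>n. R * (\<theta> * \<bar>sin (x n) / x n\<bar>)) \<longlonglongrightarrow> R * (\<theta> * \<bar>1\<bar>)"
      by (intro tendsto_intros)
    moreover have "R * (\<theta> * \<bar>sin (x n) / x n\<bar>) = f n" for n
      using assms False by (simp add: f_def x_def abs_mult)
    ultimately show ?thesis by simp
  qed
  then have "(\<lambda>n. ereal (f n)) \<longlonglongrightarrow> ereal (R * \<theta>)" by simp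
  then show "ereal (R * \<theta>) \<le> Sup ?S"
    by (rule LIMSEQ_le_const2) (use le in blast)
qed

corollary circumference_circle:
  assumes "R > 0"
  shows "curve_length (circle_point c R) 0 (2 * pi) = ereal (pi * (2 * R))"
  using curve_length_circle_arc [OF assms, of "2 * pi"] by (simp add: mult.commute mult.left_commute)

corollary radian_measure_eq_arc_length:
  assumes "\<theta> \<ge> 0"
  shows "curve_length (circle_point c 1) 0 \<theta> = ereal \<theta>"
  using curve_length_circle_arc [of 1 \<theta>] assms by simp

end

theory Submission
  imports Defs
begin

text \<open>
  Slice the disc by parallel lines. The chord at distance \<open>R * x\<close> from the centre has length
  \<open>2 * R * sqrt (1 - x\<^sup>2)\<close>, so the area is \<open>2 * R\<^sup>2\<close> times the integral of \<open>sqrt (1 - x\<^sup>2)\<close> over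
  \<open>[-1, 1]\<close>. That integral is \<open>Beta (1/2) (3/2) = Gamma (1/2) * Gamma (3/2) / Gamma 2\<close>, which is
  \<open>pi / 2\<close> because \<open>Gamma (1/2) = sqrt pi\<close>. The library carries out this slicing in every
  dimension; \<open>circle_area\<close> is the planar case.
\<close>

theorem theorem3:
  fixes c :: "real^2" and R :: real
  assumes "R > 0"
  shows "measure lebesgue (ball c R) = pi * R\<^sup>2"
proof -
  \<comment> \<open>The library measures the disc in \<open>lborel\<close>; its completion agrees there, as the disc is open.\<close>
  have "measure lebesgue (ball c R) = measure lborel (ball c R)"
    by (simp add: measure_completion)
  also have "\<dots> = pi * R\<^sup>2"
    using assms by (simp add: circle_area)
  finally show ?thesis .
qed

end
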